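(* For $k=1,2,3$ let $A_k=(a_k,b_k,c_k,d_k)\in\mathbb R^{2\times2}$ with $\det A_k=a_kd_k-b_kc_k=1$ and $b_k\neq0$. Let $f,g\in L^2(\mathbb R^3)$ be real-valued and let $\phi\in L^2(\mathbb R^3)$ be a non-zero real-valued window function. Then for all $\alpha,\beta\in\mathbb R$, $$\mathcal G^{A_1,A_2,A_3}_\phi\{\alpha f+\beta g\}=\alpha\,\mathcal G^{A_1,A_2,A_3}_\phi\{f\}+\beta\,\mathcal G^{A_1,A_2,A_3}_\phi\{g\}$$ as functions of $(w,u)\in\mathbb R^3\times\mathbb R^3$.
   Context: Octonions: $\mathbb H$ denotes the quaternions with basis $1,\mu_1,\mu_2,\mu_3$, where $\mu_1^2=\mu_2^2=\mu_3^2=-1$ and $\mu_1\mu_2=\mu_3=-\mu_2\mu_1$. The octonion algebra is $\mathbb O=\{a+b\mu_4: a,b\in\mathbb H\}$ with product $(a+b\mu_4)(c+d\mu_4)=(ac-\overline d\,b)+(da+b\,\overline c)\mu_4$. It is non-commutative and non-associative; all unbracketed products are evaluated from left to right. For $\theta\in\mathbb R$ and an imaginary unit $\mu_j$, $e^{\mu_j\theta}=\cos\theta+\mu_j\sin\theta$. Kernels: for a real matrix $A=(a,b,c,d)$ with $\det A=1$, $b\neq0$, an imaginary unit $\mu\in\{\mu_1,\mu_2,\mu_4\}$ and $s,t\in\mathbb R$, $$K^{\mu}_A(s,t)=\frac1{\sqrt{2\pi|b|}}\,e^{\frac{\mu}{2b}\left[as^2-2st+dt^2-\frac{\pi}{2}\right]}.$$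 The short-time octonion linear canonical transform (STOLCT) of a real-valued signal $f\in L^2(\mathbb R^3)$ with respect to a non-zero real-valued window $\phi\in L^2(\mathbb R^3)$ is $$\mathcal G^{A_1,A_2,A_3}_\phi\{f\}(w,u)=\int_{\mathbb R^3}f(x)\overline{\phi(x-u)}K^{\mu_1}_{A_1}(x_1,w_1)K^{\mu_2}_{A_2}(x_2,w_2)K^{\mu_4}_{A_3}(x_3,w_3)\,dx,\quad w,u\in\mathbb R^3.$$ *)

theory Defs
  imports "HOL-Analysis.Analysis"
begin

text \<open>
  Quaternions and octonions are coordinate tuples, so that the real vector space structure, the
  Euclidean norm and the Bochner integral are those of the library's product type.  Only the two
  multiplications and conjugations are defined here.
\<close>

type_synonym quaternion = "real \<times> real \<times> real \<times> real"

text \<open>The tuple \<open>(a0, a1, a2, a3)\<close> stands for \<open>a0 + a1 \<mu>1 + a2 \<mu>2 + a3 \<mu>3\<close>.\<close>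

fun quat_mult :: "quaternion \<Rightarrow> quaternion \<Rightarrow> quaternion" (infixl "\<cdot>\<^sub>H" 70) where
  "(a0, a1, a2, a3) \<cdot>\<^sub>H (b0, b1, b2, b3) =
     (a0 * b0 - a1 * b1 - a2 * b2 - a3 * b3,
      a0 * b1 + a1 * b0 + a2 * b3 - a3 * b2,
      a0 * b2 - a1 * b3 + a2 * b0 + a3 * b1,
      a0 * b3 + a1 * b2 - a2 * b1 + a3 * b0)"

fun quat_cnj :: "quaternion \<Rightarrow> quaternion" where
  "quat_cnj (a0, a1, a2, a3) = (a0, - a1, - a2, - a3)"

text \<open>The pair \<open>(a, b)\<close> stands for \<open>a + b \<mu>4\<close>.\<close>

type_synonym octonion = "quaternion \<times> quaternion"

text \<open>The product associates to the left, as the algebra is not associative.\<close>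

fun oct_mult :: "octonion \<Rightarrow> octonion \<Rightarrow> octonion" (infixl "\<cdot>\<^sub>O" 70) where
  "(a, b) \<cdot>\<^sub>O (c, d) =
     (a \<cdot>\<^sub>H c - quat_cnj d \<cdot>\<^sub>H b, d \<cdot>\<^sub>H a + b \<cdot>\<^sub>H quat_cnj c)"

fun oct_cnj :: "octonion \<Rightarrow> octonion" where
  "oct_cnj (a, b) = (quat_cnj a, - b)"

definition oct_of_real :: "real \<Rightarrow> octonion" where
  "oct_of_real r = ((r, 0, 0, 0), 0)"

definition mu1 :: octonion where "mu1 = ((0, 1, 0, 0), 0)"
definition mu2 :: octonion where "mu2 = ((0, 0, 1, 0), 0)"
definition mu3 :: octonion where "mu3 = ((0, 0, 0, 1), 0)"
definition mu4 :: octonion where "mu4 = (0, (1, 0, 0, 0))"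

lemma mu_square:
  "mu1 \<cdot>\<^sub>O mu1 = oct_of_real (- 1)" "mu2 \<cdot>\<^sub>O mu2 = oct_of_real (- 1)"
  "mu3 \<cdot>\<^sub>O mu3 = oct_of_real (- 1)" "mu4 \<cdot>\<^sub>O mu4 = oct_of_real (- 1)"
  by (simp_all add: mu1_def mu2_def mu3_def mu4_def oct_of_real_def zero_prod_def)

lemma mu1_mu2: "mu1 \<cdot>\<^sub>O mu2 = mu3" "mu2 \<cdot>\<^sub>O mu1 = - mu3"
  by (simp_all add: mu1_def mu2_def mu3_def zero_prod_def)

lemma oct_of_real_mult: "oct_of_real r \<cdot>\<^sub>O x = r *\<^sub>R x" "x \<cdot>\<^sub>O oct_of_real r = r *\<^sub>R x"
  by (cases x; auto simp: oct_of_real_def zero_prod_def)+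

text \<open>\<open>oct_cis \<mu> \<theta>\<close> is \<open>e\<close> to the power \<open>\<mu> \<theta>\<close>, for an imaginary unit \<open>\<mu>\<close>.\<close>

definition oct_cis :: "octonion \<Rightarrow> real \<Rightarrow> octonion" where
  "oct_cis \<mu> \<theta> = oct_of_real (cos \<theta>) + sin \<theta> *\<^sub>R \<mu>"

text \<open>The entries of \<open>A = (a, b, c, d)\<close> are read row by row.\<close>

definition lct_kernel :: "octonion \<Rightarrow> real^2^2 \<Rightarrow> real \<Rightarrow> real \<Rightarrow> octonion" where
  "lct_kernel \<mu> A s t =
     (let a = A $ 1 $ 1; b = A $ 1 $ 2; d = A $ 2 $ 2 in
      (1 / sqrt (2 * pi * \<bar>b\<bar>)) *\<^sub>R
        oct_cis \<mu> (1 / (2 * b) * (a * s\<^sup>2 - 2 * s * t + d * t\<^sup>2 - pi / 2)))"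

definition in_L2 :: "('a::euclidean_space \<Rightarrow> real) \<Rightarrow> bool" where
  "in_L2 f \<longleftrightarrow> f \<in> borel_measurable lebesgue \<and> integrable lebesgue (\<lambda>x. (f x)\<^sup>2)"

definition stolct ::
  "real^2^2 \<Rightarrow> real^2^2 \<Rightarrow> real^2^2 \<Rightarrow> (real^3 \<Rightarrow> real) \<Rightarrow> (real^3 \<Rightarrow> real) \<Rightarrow>
     real^3 \<Rightarrow> real^3 \<Rightarrow> octonion" where
  "stolct A1 A2 A3 \<phi> f w u =
     (LINT x|lebesgue.
        oct_of_real (f x) \<cdot>\<^sub>O oct_cnj (oct_of_real (\<phi> (x - u))) \<cdot>\<^sub>O
        lct_kernel mu1 A1 (x $ 1) (w $ 1) \<cdot>\<^sub>O
        lct_kernel mu2 A2 (x $ 2) (w $ 2) \<cdot>\<^sub>O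
        lct_kernel mu4 A3 (x $ 3) (w $ 3))"

end

theory Submission imports Defs begin

text \<open>
  Real scalars pass through the non-associative product, so the integrand is
  \<open>f x * \<phi> (x - u)\<close> times a product of three kernels.  That product is continuous
  and bounded because the octonion product is bounded bilinear, and the scalar factor is integrable
  because both of its factors are square integrable; so the integral is additive in \<open>f\<close>.
\<close>

lemma bilinear_oct_mult: "bilinear oct_mult"
  unfolding bilinear_def
  by (intro conjI allI linearI) (auto simp: algebra_simps)

text \<open>In finite dimension every bilinear map is bounded; this yields both continuity of
  products of kernels and a constant for norm estimates.\<close>

lemma bounded_bilinear_oct_mult: "bounded_bilinear oct_mult"
  using bilinear_oct_mult by (simp add: bilinear_conv_bounded_bilinear)

lemma continuous_on_lct_kernel:
  fixes p :: "'a::t2_space \<Rightarrow> real"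
  assumes "continuous_on S p"
  shows "continuous_on S (\<lambda>x. lct_kernel \<mu> A (p x) t)"
  unfolding lct_kernel_def oct_cis_def oct_of_real_def Let_def
  by (intro continuous_intros assms)

text \<open>Here \<open>\<mu>\<close> is an arbitrary octonion, so the triangle inequality replaces
  the value 1 valid for imaginary units; only uniformity in \<open>\<theta>\<close> matters.\<close>

lemma norm_oct_cis_le: "norm (oct_cis \<mu> \<theta>) \<le> 1 + norm \<mu>"
proof -
  have "norm (oct_cis \<mu> \<theta>) \<le> norm (oct_of_real (cos \<theta>)) + norm (sin \<theta> *\<^sub>R \<mu>)"
    unfolding oct_cis_def by (rule norm_triangle_ineq)
  also have "\<dots> = \<bar>cos \<theta>\<bar> + \<bar>sin \<theta>\<bar> * norm \<mu>"
    by (simp add: oct_of_real_def norm_Pair zero_prod_def)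
  also have "\<dots> \<le> 1 + norm \<mu>"
    by (intro add_mono mult_left_le_one_le) auto
  finally show ?thesis .
qed

lemma bounded_lct_kernel: "bounded (range (\<lambda>x. lct_kernel \<mu> A (p x) t))"
proof (rule boundedI)
  fix y assume "y \<in> range (\<lambda>x. lct_kernel \<mu> A (p x) t)"
  then show "norm y \<le> \<bar>1 / sqrt (2 * pi * \<bar>A $ 1 $ 2\<bar>)\<bar> * (1 + norm \<mu>)"
    unfolding lct_kernel_def Let_def
    by (auto simp only: norm_scaleR intro!: mult_left_mono norm_oct_cis_le)
qed

lemma bounded_oct_mult_range:
  assumes "bounded (range F)" and "bounded (range G)"
  shows "bounded (range (\<lambda>x. F x \<cdot>\<^sub>O G x))"
proof -
  obtain K where K: "\<And>a b. norm (a \<cdot>\<^sub>O b) \<le> norm a * norm b * K" "K > 0"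
    using bounded_bilinear.pos_bounded[OF bounded_bilinear_oct_mult] by blast
  obtain B C where "\<And>x. norm (F x) \<le> B" "\<And>x. norm (G x) \<le> C"
    using assms by (auto simp: bounded_iff)
  \<comment> \<open>Both \<open>B\<close> and \<open>C\<close> are nonnegative, being above norms,
    so the two bounds may be multiplied.\<close>
  then have "norm (F x \<cdot>\<^sub>O G x) \<le> B * C * K" for x
    using K by (meson mult_mono mult_right_mono norm_ge_zero order.trans less_imp_le)
  then show ?thesis
    by (auto intro!: boundedI)
qed

text \<open>The arithmetic-geometric mean inequality dominates the product by the sum of the
  squares.\<close>

lemma in_L2_mult_integrable:
  assumes "in_L2 f" and "in_L2 g"
  shows "integrable lebesgue (\<lambda>x. f x * g x)"
proof (rule Bochner_Integration.integrable_bound)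
  show "integrable lebesgue (\<lambda>x. (f x)\<^sup>2 + (g x)\<^sup>2)"
    using assms by (auto simp: in_L2_def)
  show "(\<lambda>x. f x * g x) \<in> borel_measurable lebesgue"
    using assms by (auto simp: in_L2_def)
  show "AE x in lebesgue. norm (f x * g x) \<le> norm ((f x)\<^sup>2 + (g x)\<^sup>2)"
  proof (rule AE_I2)
    fix x
    have "2 * (\<bar>f x\<bar> * \<bar>g x\<bar>) \<le> (f x)\<^sup>2 + (g x)\<^sup>2"
      using sum_squares_bound[of "\<bar>f x\<bar>" "\<bar>g x\<bar>"] by (simp add: mult.assoc)
    moreover have "0 \<le> \<bar>f x\<bar> * \<bar>g x\<bar>" by simp
    ultimately have "\<bar>f x\<bar> * \<bar>g x\<bar> \<le> (f x)\<^sup>2 + (g x)\<^sup>2" by linarith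
    then show "norm (f x * g x) \<le> norm ((f x)\<^sup>2 + (g x)\<^sup>2)"
      by (simp add: abs_mult)
  qed
qed

text \<open>Lebesgue measure is translation invariant, so the integral of the square can be pulled
  back along the shift.\<close>

lemma in_L2_translate:
  fixes \<phi> :: "'a::euclidean_space \<Rightarrow> real"
  assumes "in_L2 \<phi>"
  shows "in_L2 (\<lambda>x. \<phi> (x - u))"
proof -
  let ?T = "\<lambda>x. x - u"
  \<comment> \<open>The left side is a diagonal affine map with all scale factors 1 and offset
    \<open>- u\<close>, the shape in which the change of variables is stated.\<close>
  have T: "(\<lambda>x. - u + (\<Sum>j\<in>Basis. (1 * (x \<bullet> j)) *\<^sub>R j)) = ?T"
    by (simp add: euclidean_representation)
  have meas: "?T \<in> lebesgue \<rightarrow>\<^sub>M lebesgue"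
    using lebesgue_affine_measurable[of "\<lambda>_. 1" "- u"] unfolding T by simp
  \<comment> \<open>The Jacobian factor is a product of ones, so the density disappears.\<close>
  have "(lebesgue :: 'a measure) = distr lebesgue lebesgue ?T"
    using lebesgue_affine_euclidean[of "\<lambda>_. 1" "- u"] unfolding T by (simp add: density_1)
  then have "integrable (distr lebesgue lebesgue ?T) (\<lambda>x. (\<phi> x)\<^sup>2)"
    using assms by (simp add: in_L2_def)
  from integrable_distr[OF meas this] have "integrable lebesgue (\<lambda>x. (\<phi> (x - u))\<^sup>2)" .
  moreover have "(\<lambda>x. \<phi> (x - u)) \<in> borel_measurable lebesgue"
    using measurable_compose[OF meas] assms by (auto simp: in_L2_def)
  ultimately show ?thesis
    by (simp add: in_L2_def)
qed

text \<open>Continuity of \<open>K\<close> supplies measurability, and a bound on \<open>K\<close>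
  makes a multiple of \<open>h\<close> a dominating function.\<close>

lemma integrable_scaleR_bounded_continuous:
  fixes h :: "'a::euclidean_space \<Rightarrow> real" and K :: "'a \<Rightarrow> 'b::euclidean_space"
  assumes "integrable lebesgue h" and "continuous_on UNIV K" and "bounded (range K)"
  shows "integrable lebesgue (\<lambda>x. h x *\<^sub>R K x)"
proof -
  obtain B where B: "\<And>x. norm (K x) \<le> B"
    using assms(3) by (auto simp: bounded_iff)
  have "K \<in> borel_measurable borel"
    using assms(2) by (rule borel_measurable_continuous_onI)
  then have K: "K \<in> borel_measurable lebesgue"
    by (simp add: measurable_completion)
  show ?thesis
  proof (rule Bochner_Integration.integrable_bound)
    show "integrable lebesgue (\<lambda>x. B * h x)"
      using assms(1) by simp
    show "(\<lambda>x. h x *\<^sub>R K x) \<in> borel_measurable lebesgue"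
      using assms(1) K by measurable
    show "AE x in lebesgue. norm (h x *\<^sub>R K x) \<le> norm (B * h x)"
    proof (rule AE_I2)
      fix x
      have "norm (K x) \<le> \<bar>B\<bar>" using B[of x] by linarith
      then show "norm (h x *\<^sub>R K x) \<le> norm (B * h x)"
        by (simp add: abs_mult mult.commute[of "\<bar>B\<bar>"] mult_left_mono)
    qed
  qed
qed

theorem theorem4p3:
  fixes A1 A2 A3 :: "real^2^2"
    and f g \<phi> :: "real^3 \<Rightarrow> real"
    and \<alpha> \<beta> :: real
  assumes "det A1 = 1" and "det A2 = 1" and "det A3 = 1"
    and "A1 $ 1 $ 2 \<noteq> 0" and "A2 $ 1 $ 2 \<noteq> 0" and "A3 $ 1 $ 2 \<noteq> 0"
    and "in_L2 f" and "in_L2 g" and "in_L2 \<phi>"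
    and "\<not> (AE x in lebesgue. \<phi> x = 0)"
  shows "stolct A1 A2 A3 \<phi> (\<lambda>x. \<alpha> * f x + \<beta> * g x) =
    (\<lambda>w u. \<alpha> *\<^sub>R stolct A1 A2 A3 \<phi> f w u + \<beta> *\<^sub>R stolct A1 A2 A3 \<phi> g w u)"
proof (intro ext)
  fix w u :: "real^3"
  define K where "K x = lct_kernel mu1 A1 (x $ 1) (w $ 1) \<cdot>\<^sub>O lct_kernel mu2 A2 (x $ 2) (w $ 2)
    \<cdot>\<^sub>O lct_kernel mu4 A3 (x $ 3) (w $ 3)" for x :: "real^3"
  have "continuous_on UNIV K"
    unfolding K_def
    by (intro bounded_bilinear.continuous_on[OF bounded_bilinear_oct_mult] continuous_on_lct_kernel
        continuous_intros)
  moreover have "bounded (range K)"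
    unfolding K_def by (intro bounded_oct_mult_range bounded_lct_kernel)
  ultimately have int: "integrable lebesgue (\<lambda>x. (h x * \<phi> (x - u)) *\<^sub>R K x)" if "in_L2 h" for h
    using that \<open>in_L2 \<phi>\<close>
    by (intro integrable_scaleR_bounded_continuous in_L2_mult_integrable in_L2_translate)
  have oct_cnj_real: "oct_cnj (oct_of_real r) = oct_of_real r" for r
    by (simp add: oct_of_real_def)
  \<comment> \<open>The real factors sit in the leftmost slot, so left homogeneity moves them out
    one product at a time and the kernels keep their bracketing. The integrands agree pointwise,
    hence any \<open>h\<close> is allowed, in particular the linear combination.\<close>
  have stolct_eq: "stolct A1 A2 A3 \<phi> h w u = (LINT x|lebesgue. (h x * \<phi> (x - u)) *\<^sub>R K x)" for h
    by (simp add: stolct_def K_def oct_cnj_real oct_of_real_mult mult.commute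
        bilinear_lmul[OF bilinear_oct_mult])
  have "(LINT x|lebesgue. ((\<alpha> * f x + \<beta> * g x) * \<phi> (x - u)) *\<^sub>R K x) =
      (LINT x|lebesgue. \<alpha> *\<^sub>R ((f x * \<phi> (x - u)) *\<^sub>R K x) + \<beta> *\<^sub>R ((g x * \<phi> (x - u)) *\<^sub>R K x))"
    by (simp add: distrib_right scaleR_add_left mult.assoc)
  also have "\<dots> = \<alpha> *\<^sub>R (LINT x|lebesgue. (f x * \<phi> (x - u)) *\<^sub>R K x) +
      \<beta> *\<^sub>R (LINT x|lebesgue. (g x * \<phi> (x - u)) *\<^sub>R K x)"
    \<comment> \<open>Additivity requires both summands to be integrable, as a non-integrable
      function has integral 0 by convention.\<close>
    using int[OF \<open>in_L2 f\<close>] int[OF \<open>in_L2 g\<close>]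
    by (simp only: Bochner_Integration.integral_add Bochner_Integration.integral_scaleR_right
        Bochner_Integration.integrable_scaleR_right)
  finally show "stolct A1 A2 A3 \<phi> (\<lambda>x. \<alpha> * f x + \<beta> * g x) w u =
      \<alpha> *\<^sub>R stolct A1 A2 A3 \<phi> f w u + \<beta> *\<^sub>R stolct A1 A2 A3 \<phi> g w u"
    by (simp only: stolct_eq)
qed

end
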